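(* Let $\alpha>0$ and $\beta\ge 0$ be real numbers, and let $f\in\mathcal{A}$ satisfy $f(z)f'(z)/z\neq 0$ for all $z\in\mathbb{D}$. If at least one of the following inequalities holds for all $z\in\mathbb{D}$: (i) $\operatorname{Re}\left(\alpha\dfrac{Q_{CV}}{Q_{ST}}-\beta Q_{SD}Q_{CV}\right)<\dfrac{3\alpha}{2}$; (ii) $\operatorname{Re}\left(\alpha\dfrac{Q_{CV}}{Q_{ST}}-\beta Q_{SD}Q_{ST}\right)<\dfrac{3\alpha}{2}$; (iii) $\operatorname{Re}\left(\alpha\dfrac{Q_{ST}}{Q_{CV}}+\beta Q_{SD}Q_{CV}\right)>\dfrac{2\alpha}{3}$; (iv) $\operatorname{Re}\left(\alpha\dfrac{Q_{ST}}{Q_{CV}}+\beta Q_{SD}Q_{ST}\right)>\dfrac{2\alpha}{3}$; then $f$ is starlike.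
   Context: $\mathbb{D}=\{z\in\mathbb{C}:|z|<1\}$. $\mathcal{A}$ is the class of analytic functions $f:\mathbb{D}\to\mathbb{C}$ with $f(0)=0$ and $f'(0)=1$. For $f\in\mathcal{A}$, as functions of $z\in\mathbb{D}$: $Q_{ST}=zf'(z)/f(z)$ (with the removable singularity at $z=0$ filled in, value $1$), $Q_{CV}=1+zf''(z)/f'(z)$, and $Q_{SD}=z^2\Big(\big(f''(z)/f'(z)\big)'-\tfrac12\big(f''(z)/f'(z)\big)^2\Big)$ ($z^2$ times the Schwarzian derivative of $f$). The condition $f(z)f'(z)/z\neq0$ is understood at $z=0$ via the removable singularity (where the value is $1$). An inequality containing a quotient is understood to include the requirement that the denominators appearing in it do not vanish in $\mathbb{D}$. A function $f\in\mathcal{A}$ is starlike if $\operatorname{Re}Q_{ST}>0$ on $\mathbb{D}$; equivalently, $f$ is univalent and $tf(z)\in f(\mathbb{D})$ for all $z\in\mathbb{D}$, $t\in[0,1]$. *)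

theory Defs
  imports "HOL-Complex_Analysis.Complex_Analysis"
begin

definition class_A :: "(complex \<Rightarrow> complex) \<Rightarrow> bool" where
  "class_A f \<longleftrightarrow> f analytic_on ball 0 1 \<and> f 0 = 0 \<and> deriv f 0 = 1"

(* In Q_ST and quot_prod the value 1 at the origin fills in a removable
   singularity; see Q_ST_tendsto and quot_prod_tendsto. *)

definition Q_ST :: "(complex \<Rightarrow> complex) \<Rightarrow> complex \<Rightarrow> complex" where
  "Q_ST f z = (if z = 0 then 1 else z * deriv f z / f z)"

definition Q_CV :: "(complex \<Rightarrow> complex) \<Rightarrow> complex \<Rightarrow> complex" where
  "Q_CV f z = 1 + z * deriv (deriv f) z / deriv f z"

definition schwarzian :: "(complex \<Rightarrow> complex) \<Rightarrow> complex \<Rightarrow> complex" where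
  "schwarzian f z =
     deriv (\<lambda>w. deriv (deriv f) w / deriv f w) z - 1/2 * (deriv (deriv f) z / deriv f z)\<^sup>2"

definition Q_SD :: "(complex \<Rightarrow> complex) \<Rightarrow> complex \<Rightarrow> complex" where
  "Q_SD f z = z\<^sup>2 * schwarzian f z"

definition quot_prod :: "(complex \<Rightarrow> complex) \<Rightarrow> complex \<Rightarrow> complex" where
  "quot_prod f z = (if z = 0 then 1 else f z * deriv f z / z)"

(* The first conjunct in the scope of the quantifier says that f z / z, the
   denominator of Q_ST (equal to deriv f 0 = 1 at the origin), does not vanish. *)

definition starlike_fn :: "(complex \<Rightarrow> complex) \<Rightarrow> bool" where
  "starlike_fn f \<longleftrightarrow> class_A f \<and>
     (\<forall>z\<in>ball 0 1. (z \<noteq> 0 \<longrightarrow> f z \<noteq> 0) \<and> Re (Q_ST f z) > 0)"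

lemma class_A_limits:
  assumes "class_A f"
  shows "((\<lambda>z. f z / z) \<longlongrightarrow> 1) (at 0)" and "(deriv f \<longlongrightarrow> 1) (at 0)"
proof -
  have f: "f analytic_on {0}" "f 0 = 0" "deriv f 0 = 1"
    using assms analytic_on_subset[of f "ball 0 1" "{0}"] by (auto simp: class_A_def)
  have "(f has_field_derivative 1) (at 0)"
    using DERIV_deriv_iff_field_differentiable[of f 0]
      analytic_on_imp_differentiable_at[OF f(1)] f(3) by simp
  then show "((\<lambda>z. f z / z) \<longlongrightarrow> 1) (at 0)"
    using f(2) by (simp add: has_field_derivative_iff)
  have "isCont (deriv f) 0"
    using f(1) by (intro analytic_at_imp_isCont analytic_deriv)
  then show "(deriv f \<longlongrightarrow> 1) (at 0)"
    using f(3) by (simp add: isCont_def)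
qed

lemma Q_ST_tendsto:
  assumes "class_A f"
  shows "(Q_ST f \<longlongrightarrow> Q_ST f 0) (at 0)"
proof -
  have "((\<lambda>z. deriv f z / (f z / z)) \<longlongrightarrow> 1 / 1) (at 0)"
    using class_A_limits[OF assms] by (intro tendsto_divide) auto
  moreover have "\<forall>\<^sub>F z in at 0. deriv f z / (f z / z) = Q_ST f z"
    by (auto simp: Q_ST_def eventually_at_filter)
  ultimately have "(Q_ST f \<longlongrightarrow> 1 / 1) (at 0)"
    by (rule Lim_transform_eventually)
  then show ?thesis
    by (simp add: Q_ST_def[of f 0])
qed

lemma quot_prod_tendsto:
  assumes "class_A f"
  shows "(quot_prod f \<longlongrightarrow> quot_prod f 0) (at 0)"
proof -
  have "((\<lambda>z. (f z / z) * deriv f z) \<longlongrightarrow> 1 * 1) (at 0)"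
    using class_A_limits[OF assms] by (intro tendsto_mult)
  moreover have "\<forall>\<^sub>F z in at 0. (f z / z) * deriv f z = quot_prod f z"
    by (auto simp: quot_prod_def eventually_at_filter)
  ultimately have "(quot_prod f \<longlongrightarrow> 1 * 1) (at 0)"
    by (rule Lim_transform_eventually)
  then show ?thesis
    by (simp add: quot_prod_def[of f 0])
qed

end

theory Submission
  imports Defs
begin

text \<open>
  Write \<open>p = zf'/f\<close>, which is holomorphic and zero-free on the disc with \<open>p(0) = 1\<close>. If \<open>Re p\<close> is not
  positive throughout, let \<open>z\<close> be a point of least modulus at which \<open>p\<close> has left the open right
  half-plane, so that \<open>p(z) = ir\<close> with \<open>r\<close> real and nonzero. At such a point the derivatives of \<open>p\<close>
  are constrained: \<open>Re p\<close> restricted to the circle through \<open>z\<close> has a minimum there, hence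
  \<open>s = zp'(z)\<close> is real and \<open>T = zp'(z) + z\<^sup>2p''(z)\<close> has \<open>Re T \<le> 0\<close>
  (\<open>angular_derivatives_at_boundary_zero\<close>); and Schwarz's lemma applied to the Cayley transform of
  \<open>p\<close> gives \<open>s \<le> -(1 + r\<^sup>2)/2\<close> (\<open>radial_derivative_at_boundary_zero\<close>).

  Logarithmic differentiation expresses \<open>Q_CV\<close> and \<open>Q_SD\<close> through \<open>p\<close>, \<open>zp'\<close> and \<open>z\<^sup>2p''\<close>
  (\<open>Q_CV_eq\<close>, \<open>Q_SD_eq\<close>). At the exit point these formulas collapse. First,
  \<open>Q_CV = kp\<close> with \<open>k = 1 - s/r\<^sup>2\<close> real, and the bound on \<open>s\<close> gives \<open>k > 3/2\<close>. Secondly, every term of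
  \<open>Q_SD\<close> other than \<open>T/p\<close> is real while \<open>p\<close> is purely imaginary, so
  \<open>Re (Q_SD p) = Re T \<le> 0\<close>, and therefore also \<open>Re (Q_SD Q_CV) = k Re T \<le> 0\<close>. Thus
  \<open>\<alpha> Q_CV/Q_ST = \<alpha>k\<close> exceeds \<open>3\<alpha>/2\<close>, its counterpart \<open>\<alpha> Q_ST/Q_CV = \<alpha>/k\<close> lies below \<open>2\<alpha>/3\<close>, and in
  each of the four inequalities the Schwarzian term only makes matters worse, so all four fail at
  that one point.
\<close>

section \<open>First exit of a holomorphic function from the right half-plane\<close>

lemma second_derivative_nonneg_at_global_min:
  fixes u u' :: "real \<Rightarrow> real"
  assumes min: "\<And>t. u x \<le> u t"
    and u: "\<And>t. (u has_real_derivative u' t) (at t)"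
    and u': "(u' has_real_derivative d) (at x)"
  shows "u' x = 0" and "d \<ge> 0"
proof -
  show crit: "u' x = 0"
    by (rule DERIV_local_min[OF u zero_less_one]) (use min in auto)
  show "d \<ge> 0"
  proof (rule ccontr)
    assume "\<not> d \<ge> 0"
    then obtain \<delta> where \<delta>: "\<delta> > 0" "\<And>h. 0 < h \<Longrightarrow> h < \<delta> \<Longrightarrow> u' (x + h) < u' x"
      using DERIV_neg_dec_right[OF u'] by auto
    obtain y where y: "x < y" "y < x + \<delta>/2" "u (x + \<delta>/2) - u x = (x + \<delta>/2 - x) * u' y"
      using MVT2[of x "x + \<delta>/2" u u'] u \<delta>(1) by auto
    have "u' y < 0"
      using \<delta>(2)[of "y - x"] y(1,2) \<delta>(1) crit by simp
    then have "u (x + \<delta>/2) < u x"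
      using y(3) mult_pos_neg[of "\<delta>/2" "u' y"] \<delta>(1) by simp
    then show False
      using min[of "x + \<delta>/2"] by simp
  qed
qed

text \<open>
  A point of least modulus with \<open>Re p \<le> 0\<close> exists by compactness. On the open disc that it bounds
  \<open>Re p\<close> is positive, so continuity forces \<open>Re p = 0\<close> at the point itself.
\<close>

lemma first_zero_of_Re:
  assumes hol: "p holomorphic_on ball 0 1" and p0: "Re (p 0) > 0"
    and \<zeta>: "\<zeta> \<in> ball 0 1" "Re (p \<zeta>) \<le> 0"
  obtains z where "z \<in> ball 0 1" "z \<noteq> 0" "Re (p z) = 0"
    "\<And>w. norm w < norm z \<Longrightarrow> Re (p w) > 0"
    "\<And>w. norm w \<le> norm z \<Longrightarrow> Re (p w) \<ge> 0"
proof -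
  define K where "K = {w \<in> cball 0 (norm \<zeta>). Re (p w) \<le> 0}"
  have cont: "continuous_on (cball 0 r) (\<lambda>w. Re (p w))" if "r < 1" for r
    by (intro continuous_intros holomorphic_on_imp_continuous_on[OF holomorphic_on_subset[OF hol]])
       (use that in auto)
  have "compact K"
    unfolding K_def compact_eq_bounded_closed
    using continuous_closed_preimage[OF cont[of "norm \<zeta>"], of "{..0}"] \<zeta>(1)
    by (auto simp: vimage_def Int_def intro: bounded_subset[OF bounded_cball[of 0 "norm \<zeta>"]])
  moreover have "\<zeta> \<in> K"
    using \<zeta> by (simp add: K_def)
  ultimately obtain z where z: "z \<in> K" "\<And>w. w \<in> K \<Longrightarrow> norm z \<le> norm w"
    using continuous_attains_inf[of K norm] by (auto intro: continuous_intros)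
  have zball: "norm z < 1"
    using z(1) \<zeta>(1) by (simp add: K_def)
  have znz: "z \<noteq> 0"
    using z(1) p0 by (auto simp: K_def)
  have pos: "Re (p w) > 0" if "norm w < norm z" for w
    using z(2)[of w] z(1) that by (auto simp: K_def not_le[symmetric])
  have nonneg: "Re (p w) \<ge> 0" if "norm w \<le> norm z" for w
  proof (rule continuous_ge_on_closure[where S = "ball 0 (norm z)" and f = "\<lambda>w. Re (p w)"])
    show "continuous_on (closure (ball (0::complex) (norm z))) (\<lambda>w. Re (p w))"
      using cont[OF zball] znz by simp
    show "w \<in> closure (ball (0::complex) (norm z))"
      using that znz by simp
  qed (use pos in \<open>auto intro: less_imp_le\<close>)
  have "Re (p z) = 0"
    using nonneg[of z] z(1) by (simp add: K_def)
  then show ?thesis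
    using that zball znz pos nonneg by simp
qed

lemma has_real_derivative_Re_along_curve:
  assumes "(q has_field_derivative q') (at (\<gamma> t))"
    and "(\<gamma> has_vector_derivative \<gamma>') (at t)"
  shows "((\<lambda>t. Re (q (\<gamma> t))) has_real_derivative Re (\<gamma>' * q')) (at t)"
    and "((\<lambda>t. Im (q (\<gamma> t))) has_real_derivative Im (\<gamma>' * q')) (at t)"
proof -
  have *: "((\<lambda>t. q (\<gamma> t)) has_vector_derivative \<gamma>' * q') (at t)"
    using field_vector_diff_chain_at[OF assms(2,1)] by (simp add: o_def)
  show "((\<lambda>t. Re (q (\<gamma> t))) has_real_derivative Re (\<gamma>' * q')) (at t)"
    using bounded_linear.has_vector_derivative[OF bounded_linear_Re *] by (simp add: has_real_derivative_iff_has_vector_derivative)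
  show "((\<lambda>t. Im (q (\<gamma> t))) has_real_derivative Im (\<gamma>' * q')) (at t)"
    using bounded_linear.has_vector_derivative[OF bounded_linear_Im *] by (simp add: has_real_derivative_iff_has_vector_derivative)
qed

text \<open>
  Along the circle \<open>\<gamma>(t) = z exp(it)\<close> the function \<open>Re (p \<circ> \<gamma>)\<close> is minimal at \<open>t = 0\<close>. Since
  \<open>\<gamma>' = i\<gamma>\<close>, each differentiation in \<open>t\<close> acts as \<open>i\<close> times the Euler operator \<open>w d/dw\<close>; the first-
  and second-order conditions for a minimum are exactly the two conclusions.
\<close>

lemma angular_derivatives_at_boundary_zero:
  assumes hol: "p holomorphic_on ball 0 1" and z: "z \<in> ball 0 1" "Re (p z) = 0"
    and nonneg: "\<And>w. norm w \<le> norm z \<Longrightarrow> Re (p w) \<ge> 0"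
  shows "Im (z * deriv p z) = 0"
    and "Re (z * deriv p z + z\<^sup>2 * deriv (deriv p) z) \<le> 0"
proof -
  define \<gamma> where "\<gamma> t = z * cis t" for t
  have \<gamma>: "(\<gamma> has_vector_derivative \<i> * \<gamma> t) (at t)" for t
    unfolding \<gamma>_def by (auto intro!: derivative_eq_intros simp: has_vector_derivative_def scaleR_conv_of_real)
  have \<gamma>_ball: "\<gamma> t \<in> ball 0 1" for t
    using z(1) by (simp add: \<gamma>_def norm_mult)
  define q where "q w = \<i> * w * deriv p w" for w
  have p': "(p has_field_derivative deriv p w) (at w)" if "w \<in> ball 0 1" for w
    using holomorphic_derivI[OF hol open_ball that] .
  have p'': "(deriv p has_field_derivative deriv (deriv p) w) (at w)" if "w \<in> ball 0 1" for w
    using holomorphic_derivI[OF holomorphic_deriv[OF hol open_ball] open_ball that] .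
  have q': "(q has_field_derivative \<i> * deriv p w + \<i> * w * deriv (deriv p) w) (at w)"
    if "w \<in> ball 0 1" for w
    unfolding q_def using p''[OF that] by (auto intro!: derivative_eq_intros)
  have u: "((\<lambda>t. Re (p (\<gamma> t))) has_real_derivative Re (q (\<gamma> t))) (at t)" for t
    using has_real_derivative_Re_along_curve(1)[OF p'[OF \<gamma>_ball] \<gamma>] by (simp add: q_def)
  have u': "((\<lambda>t. Re (q (\<gamma> t))) has_real_derivative
      Re (\<i> * \<gamma> 0 * (\<i> * deriv p (\<gamma> 0) + \<i> * \<gamma> 0 * deriv (deriv p) (\<gamma> 0)))) (at 0)"
    using has_real_derivative_Re_along_curve(1)[OF q'[OF \<gamma>_ball] \<gamma>] .
  have min: "Re (p (\<gamma> 0)) \<le> Re (p (\<gamma> t))" for t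
    using z(2) nonneg[of "\<gamma> t"] by (simp add: \<gamma>_def norm_mult)
  note test = second_derivative_nonneg_at_global_min[OF min u u']
  have "\<gamma> 0 = z"
    by (simp add: \<gamma>_def)
  with test show "Im (z * deriv p z) = 0"
    by (simp add: q_def)
  have "\<i> * z * (\<i> * deriv p z + \<i> * z * deriv (deriv p) z)
      = - (z * deriv p z + z\<^sup>2 * deriv (deriv p) z)"
    by (simp add: algebra_simps power2_eq_square)
  with test(2) \<open>\<gamma> 0 = z\<close> show "Re (z * deriv p z + z\<^sup>2 * deriv (deriv p) z) \<le> 0"
    by (metis neg_0_le_iff_le uminus_complex.sel(1))
qed

text \<open>
  Schwarz's lemma for \<open>(p - 1)/(p + 1)\<close>, which maps the disc of radius \<open>norm z\<close> into the unit disc and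
  fixes the origin. Rescaling the variable by the complex number \<open>z\<close> puts the boundary point of
  interest at \<open>1\<close>.
\<close>

lemma Schwarz_Cayley:
  assumes hol: "p holomorphic_on ball 0 1" and p0: "p 0 = 1" and z: "z \<in> ball 0 1"
    and pos: "\<And>w. norm w < norm z \<Longrightarrow> Re (p w) > 0"
    and t: "0 \<le> t" "t < 1"
  shows "norm (p (of_real t * z) - 1) \<le> t * norm (p (of_real t * z) + 1)"
proof (cases "z = 0")
  case True
  then show ?thesis using p0 t by simp
next
  case False
  define F where "F w = (p (w * z) - 1) / (p (w * z) + 1)" for w
  have Re_pos: "Re (p (w * z)) > 0" if "norm w < 1" for w
    by (rule pos) (use that False in \<open>simp add: norm_mult\<close>)
  have nz: "p (w * z) + 1 \<noteq> 0" if "norm w < 1" for w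
    using Re_pos[OF that] by (auto simp: complex_eq_iff)
  have maps: "w * z \<in> ball 0 1" if "norm w < 1" for w
    using that z mult_strict_mono[of "norm w" 1 "norm z" 1] by (simp add: norm_mult)
  have comp: "(\<lambda>w. p (w * z)) holomorphic_on ball 0 1"
    by (rule holomorphic_on_compose_gen[OF _ hol, of "\<lambda>w. w * z", unfolded o_def])
       (use maps in \<open>auto intro!: holomorphic_intros\<close>)
  have "norm (F (of_real t)) \<le> norm (of_real t :: complex)"
  proof (rule Schwarz_Lemma(1))
    show "F holomorphic_on ball 0 1"
      unfolding F_def using comp nz by (intro holomorphic_intros) auto
    show "F 0 = 0"
      by (simp add: F_def p0)
    show "norm (F w) < 1" if "norm w < 1" for w
    proof -
      have "norm (p (w * z) - 1) ^ 2 < norm (p (w * z) + 1) ^ 2"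
        unfolding cmod_power2 using Re_pos[OF that] by (simp add: power2_eq_square algebra_simps)
      then have "norm (p (w * z) - 1) < norm (p (w * z) + 1)"
        by (rule power_less_imp_less_base) simp
      then show ?thesis
        using nz[OF that] by (simp add: F_def norm_divide)
    qed
  qed (use t in simp)
  then show ?thesis
    using nz[of "of_real t"] t by (simp add: F_def norm_divide pos_divide_le_eq)
qed

text \<open>
  Squared, the preceding estimate says that \<open>h(t) = t\<^sup>2|p(tz) + 1|\<^sup>2 - |p(tz) - 1|\<^sup>2\<close> is nonnegative for
  \<open>0 \<le> t < 1\<close>. It vanishes at \<open>t = 1\<close>, because purely imaginary points are equidistant from \<open>1\<close> and
  \<open>-1\<close>. Hence \<open>h'(1) \<le> 0\<close>, and this is the claim.
\<close>

lemma radial_derivative_at_boundary_zero: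
  assumes hol: "p holomorphic_on ball 0 1" and p0: "p 0 = 1"
    and z: "z \<in> ball 0 1" "Re (p z) = 0"
    and pos: "\<And>w. norm w < norm z \<Longrightarrow> Re (p w) > 0"
  shows "Re (z * deriv p z) \<le> - (1 + (Im (p z))\<^sup>2) / 2"
proof -
  define a b where "a t = Re (p (of_real t * z))" and "b t = Im (p (of_real t * z))" for t :: real
  define h where "h t = t\<^sup>2 * ((a t + 1)\<^sup>2 + (b t)\<^sup>2) - ((a t - 1)\<^sup>2 + (b t)\<^sup>2)" for t
  have nonneg: "h t \<ge> 0" if "0 \<le> t" "t < 1" for t
  proof -
    have "norm (p (of_real t * z) - 1) ^ 2 \<le> (t * norm (p (of_real t * z) + 1)) ^ 2"
      using Schwarz_Cayley[OF hol p0 z(1) pos that] by (intro power_mono) auto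
    then show ?thesis
      by (simp add: h_def a_def b_def power_mult_distrib cmod_power2)
  qed
  have curve: "((\<lambda>t. of_real t * z) has_vector_derivative z) (at 1)"
    by (auto intro!: derivative_eq_intros simp: has_vector_derivative_def scaleR_conv_of_real)
  have p': "(p has_field_derivative deriv p z) (at (of_real 1 * z))"
    using holomorphic_derivI[OF hol open_ball z(1)] by simp
  have a': "(a has_real_derivative Re (z * deriv p z)) (at 1)"
    and b': "(b has_real_derivative Im (z * deriv p z)) (at 1)"
    unfolding a_def b_def
    using has_real_derivative_Re_along_curve[OF p' curve] by simp_all
  have ab: "a 1 = 0" "b 1 = Im (p z)"
    using z(2) by (simp_all add: a_def b_def)
  have h': "(h has_real_derivative 2 * (1 + (Im (p z))\<^sup>2) + 4 * Re (z * deriv p z)) (at 1)"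
    unfolding h_def
    by (rule derivative_eq_intros a' b' refl)+ (simp add: ab algebra_simps power2_eq_square)
  show ?thesis
  proof (rule ccontr)
    assume "\<not> ?thesis"
    then have "2 * (1 + (Im (p z))\<^sup>2) + 4 * Re (z * deriv p z) > 0"
      by (simp add: field_simps)
    then obtain \<delta> where \<delta>: "\<delta> > 0" "\<And>e. 0 < e \<Longrightarrow> e < \<delta> \<Longrightarrow> h (1 - e) < h 1"
      using DERIV_pos_inc_left[OF h'] by blast
    \<comment> \<open>The step is capped so that \<open>1 - e\<close> stays in the range where \<open>h\<close> is known to be nonnegative.\<close>
    define e where "e = min (\<delta>/2) 1"
    have "h (1 - e) < h 1"
      using \<delta> by (simp add: e_def)
    moreover have "h (1 - e) \<ge> 0"
      using \<delta>(1) by (intro nonneg) (auto simp: e_def)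
    moreover have "h 1 = 0"
      by (simp add: h_def ab)
    ultimately show False by simp
  qed
qed

section \<open>The three expressions in terms of zf'/f\<close>

locale class_A_nonvanishing =
  fixes f :: "complex \<Rightarrow> complex"
  assumes class_A: "class_A f"
    and nonvanishing: "\<And>z. z \<in> ball 0 1 \<Longrightarrow> quot_prod f z \<noteq> 0"
begin

lemma f_nonzero: "z \<in> ball 0 1 \<Longrightarrow> z \<noteq> 0 \<Longrightarrow> f z \<noteq> 0"
  using nonvanishing[of z] by (auto simp: quot_prod_def)

lemma deriv_nonzero: "z \<in> ball 0 1 \<Longrightarrow> deriv f z \<noteq> 0"
  using nonvanishing[of z] class_A by (cases "z = 0") (auto simp: quot_prod_def class_A_def)

lemma f_holomorphic: "f holomorphic_on ball 0 1"
  using class_A by (simp add: class_A_def analytic_imp_holomorphic)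

lemma f_derivs:
  assumes "z \<in> ball 0 1"
  shows "(f has_field_derivative deriv f z) (at z)"
    and "(deriv f has_field_derivative deriv (deriv f) z) (at z)"
    and "(deriv (deriv f) has_field_derivative deriv (deriv (deriv f)) z) (at z)"
  by (rule holomorphic_derivI[OF _ open_ball assms],
      intro holomorphic_deriv f_holomorphic open_ball)+

lemma Q_ST_at_0: "Q_ST f 0 = 1"
  by (simp add: Q_ST_def)

lemma Q_ST_nonzero: "z \<in> ball 0 1 \<Longrightarrow> Q_ST f z \<noteq> 0"
  using f_nonzero deriv_nonzero by (auto simp: Q_ST_def)

text \<open>
  Writing \<open>f(z) = z h(z)\<close> with \<open>h\<close> holomorphic and zero-free turns the quotient into \<open>f'/h\<close>, which has
  no singularity at the origin.
\<close>

lemma Q_ST_holomorphic: "Q_ST f holomorphic_on ball 0 1"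
proof -
  obtain h where h: "h holomorphic_on ball 0 1" "\<And>z. norm z < 1 \<Longrightarrow> f z = z * h z"
      "deriv f 0 = h 0"
    using Schwarz3[OF f_holomorphic] class_A by (auto simp: class_A_def)
  have h0: "h 0 = 1"
    using h(3) class_A by (simp add: class_A_def)
  have hnz: "h z \<noteq> 0" if "z \<in> ball 0 1" for z
    using f_nonzero[OF that] h(2)[of z] that h0 by (cases "z = 0") auto
  have "(\<lambda>z. deriv f z / h z) holomorphic_on ball 0 1"
    using h(1) hnz by (intro holomorphic_intros f_holomorphic) auto
  moreover have "deriv f z / h z = Q_ST f z" if "z \<in> ball 0 1" for z
    using h(2)[of z] h(3) h0 that by (simp add: Q_ST_def)
  ultimately show ?thesis
    using holomorphic_transform by fastforce
qed

lemma Q_ST_derivs: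
  assumes "z \<in> ball 0 1"
  shows "(Q_ST f has_field_derivative deriv (Q_ST f) z) (at z)"
    and "(deriv (Q_ST f) has_field_derivative deriv (deriv (Q_ST f)) z) (at z)"
  by (rule holomorphic_derivI[OF _ open_ball assms],
      intro holomorphic_deriv Q_ST_holomorphic open_ball)+

text \<open>
  Differentiate \<open>zf' = pf\<close>, where \<open>p = Q_ST f\<close>, divide by \<open>f'\<close>, and use \<open>f/f' = z/p\<close>.
\<close>

lemma Q_CV_eq:
  assumes z: "z \<in> ball 0 1"
  shows "Q_CV f z = Q_ST f z + z * deriv (Q_ST f) z / Q_ST f z"
proof (cases "z = 0")
  case True
  then show ?thesis by (simp add: Q_CV_def Q_ST_at_0)
next
  case False
  have eq: "w * deriv f w = Q_ST f w * f w" if "w \<in> ball 0 1" for w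
    using f_nonzero[OF that] class_A by (auto simp: Q_ST_def class_A_def)
  have "((\<lambda>w. w * deriv f w) has_field_derivative deriv f z + z * deriv (deriv f) z) (at z)"
    using f_derivs(2)[OF z] by (auto intro!: derivative_eq_intros)
  moreover have "((\<lambda>w. w * deriv f w) has_field_derivative
      deriv (Q_ST f) z * f z + Q_ST f z * deriv f z) (at z)"
    by (rule has_field_derivative_transform_within_open
          [where f = "\<lambda>w. Q_ST f w * f w" and S = "ball 0 1"])
       (use z eq f_derivs(1)[OF z] Q_ST_derivs(1)[OF z] in \<open>auto intro!: derivative_eq_intros\<close>)
  ultimately have "deriv f z + z * deriv (deriv f) z = deriv (Q_ST f) z * f z + Q_ST f z * deriv f z"
    by (rule DERIV_unique)
  then have "Q_CV f z = Q_ST f z + deriv (Q_ST f) z * (f z / deriv f z)"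
    using deriv_nonzero[OF z] by (simp add: Q_CV_def field_simps)
  moreover have "f z / deriv f z = z / Q_ST f z"
    using False deriv_nonzero[OF z] f_nonzero[OF z] by (simp add: Q_ST_def)
  ultimately show ?thesis by simp
qed

text \<open>
  With \<open>G = f''/f'\<close> the previous formula reads \<open>zG = p + zp'/p - 1\<close>. Differentiating and multiplying
  by \<open>z\<close> gives \<open>zG + z\<^sup>2G'\<close>, while \<open>Q_SD = z\<^sup>2G' - (zG)\<^sup>2/2\<close> with \<open>zG = Q_CV - 1\<close>.
\<close>

lemma Q_SD_eq:
  assumes z: "z \<in> ball 0 1"
  shows "Q_SD f z = z * deriv (Q_ST f) z
    + (z * deriv (Q_ST f) z + z\<^sup>2 * deriv (deriv (Q_ST f)) z) / Q_ST f z
    - (z * deriv (Q_ST f) z / Q_ST f z)\<^sup>2 + (1 - (Q_CV f z)\<^sup>2) / 2"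
proof -
  define G where "G = (\<lambda>w. deriv (deriv f) w / deriv f w)"
  define P P1 P2 where "P = Q_ST f" and "P1 = deriv P" and "P2 = deriv P1"
  note P_defs = P_def P1_def P2_def
  have Pnz: "P z \<noteq> 0"
    using Q_ST_nonzero[OF z] by (simp add: P_def)
  have zG: "w * G w = Q_CV f w - 1" for w
    by (simp add: G_def Q_CV_def)
  have "G field_differentiable at z"
    unfolding G_def field_differentiable_def
    using DERIV_divide[OF f_derivs(3,2)[OF z]] deriv_nonzero[OF z] by blast
  then have G': "(G has_field_derivative deriv G z) (at z)"
    by (rule field_differentiable_derivI)
  have "((\<lambda>w. w * G w) has_field_derivative G z + z * deriv G z) (at z)"
    using G' by (auto intro!: derivative_eq_intros)
  moreover have "((\<lambda>w. w * G w) has_field_derivative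
      P1 z + ((P1 z + z * P2 z) * P z - z * P1 z * P1 z) / (P z * P z)) (at z)"
  proof (rule has_field_derivative_transform_within_open
      [where f = "\<lambda>w. P w + w * P1 w / P w - 1" and S = "ball 0 1"])
    show "((\<lambda>w. P w + w * P1 w / P w - 1) has_field_derivative
      P1 z + ((P1 z + z * P2 z) * P z - z * P1 z * P1 z) / (P z * P z)) (at z)"
      using Q_ST_derivs[OF z] Pnz unfolding P_defs[symmetric]
      by (auto intro!: derivative_eq_intros)
    show "P w + w * P1 w / P w - 1 = w * G w" if "w \<in> ball 0 1" for w
      using Q_CV_eq[OF that] by (simp add: zG P_defs)
  qed (use z in auto)
  ultimately have "G z + z * deriv G z
      = P1 z + ((P1 z + z * P2 z) * P z - z * P1 z * P1 z) / (P z * P z)"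
    by (rule DERIV_unique)
  then have "z * G z + z\<^sup>2 * deriv G z
      = z * (P1 z + ((P1 z + z * P2 z) * P z - z * P1 z * P1 z) / (P z * P z))"
    by (metis distrib_left mult.assoc power2_eq_square)
  also have "\<dots> = z * P1 z + (z * P1 z + z\<^sup>2 * P2 z) / P z - (z * P1 z / P z)\<^sup>2"
    using Pnz by (simp add: field_simps power2_eq_square)
  finally have "z\<^sup>2 * deriv G z = z * P1 z + (z * P1 z + z\<^sup>2 * P2 z) / P z
      - (z * P1 z / P z)\<^sup>2 - (Q_CV f z - 1)"
    by (simp add: zG algebra_simps)
  moreover have "Q_SD f z = z\<^sup>2 * deriv G z - (z * G z)\<^sup>2 / 2"
    by (simp add: Q_SD_def schwarzian_def G_def algebra_simps power2_eq_square)
  moreover have "e - (c - 1) - (c - 1)\<^sup>2 / 2 = e + (1 - c\<^sup>2) / 2" for c e :: complex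
    by (simp add: power2_eq_square field_simps)
  ultimately show ?thesis
    by (simp only: zG P_defs)
qed

section \<open>Values at the first exit point\<close>

text \<open>
  Everything that the four inequalities need: at the exit point \<open>Q_CV\<close> is a real multiple of the
  purely imaginary \<open>Q_ST\<close>, so both the quotients and the sign of \<open>Re (Q_SD Q_CV)\<close> are governed by
  \<open>k\<close> and \<open>Re (Q_SD Q_ST)\<close>.
\<close>

lemma first_exit_values:
  assumes "\<zeta> \<in> ball 0 1" "Re (Q_ST f \<zeta>) \<le> 0"
  obtains z k where "z \<in> ball 0 1" "k > 3/2"
    "Q_CV f z = of_real k * Q_ST f z"
    "Re (Q_SD f z * Q_ST f z) \<le> 0"
proof -
  have pos0: "Re (Q_ST f 0) > 0"
    by (simp add: Q_ST_at_0)
  obtain z where z: "z \<in> ball 0 1" "z \<noteq> 0" "Re (Q_ST f z) = 0"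
    and pos: "\<And>w. norm w < norm z \<Longrightarrow> Re (Q_ST f w) > 0"
    and nonneg: "\<And>w. norm w \<le> norm z \<Longrightarrow> Re (Q_ST f w) \<ge> 0"
    using first_zero_of_Re[OF Q_ST_holomorphic pos0 assms] by metis
  define r where "r = Im (Q_ST f z)"
  define s where "s = Re (z * deriv (Q_ST f) z)"
  define T where "T = z * deriv (Q_ST f) z + z\<^sup>2 * deriv (deriv (Q_ST f)) z"
  define k where "k = 1 - s / r\<^sup>2"
  have P: "Q_ST f z = \<i> * of_real r"
    using z(3) by (simp add: r_def complex_eq_iff)
  have rnz: "r \<noteq> 0"
    using Q_ST_nonzero[OF z(1)] P by auto
  have S: "z * deriv (Q_ST f) z = of_real s"
    using angular_derivatives_at_boundary_zero(1)[OF Q_ST_holomorphic z(1,3) nonneg]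
    by (simp add: s_def complex_eq_iff)
  have T: "Re T \<le> 0"
    using angular_derivatives_at_boundary_zero(2)[OF Q_ST_holomorphic z(1,3) nonneg]
    by (simp add: T_def)
  have s: "s \<le> - (1 + r\<^sup>2) / 2"
    using radial_derivative_at_boundary_zero[OF Q_ST_holomorphic Q_ST_at_0 z(1,3) pos]
    by (simp add: s_def r_def)
  have CV: "Q_CV f z = of_real k * Q_ST f z"
    using rnz by (simp add: Q_CV_eq[OF z(1)] P S k_def field_simps power2_eq_square)
  have "k > 3/2"
    using s rnz by (simp add: k_def field_simps)
  moreover
  \<comment> \<open>Only the summand \<open>T / Q_ST f z\<close> of \<open>Q_SD f z\<close> can fail to be real.\<close>
  have "Q_SD f z * Q_ST f z = \<i> * of_real (r * (s + (s / r)\<^sup>2 + (1 + (k * r)\<^sup>2) / 2)) + T"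
    unfolding Q_SD_eq[OF z(1)] T_def[symmetric] unfolding S CV P
    using rnz by (simp add: field_simps power2_eq_square)
  then have "Re (Q_SD f z * Q_ST f z) = Re T"
    by simp
  ultimately show ?thesis
    using that z(1) CV T by simp
qed

end

theorem theorem2p19:
  fixes \<alpha> \<beta> :: real and f :: "complex \<Rightarrow> complex"
  assumes "\<alpha> > 0" and "\<beta> \<ge> 0"
    and "class_A f"
    and "\<forall>z\<in>ball 0 1. quot_prod f z \<noteq> 0"
    and "(\<forall>z\<in>ball 0 1. Q_ST f z \<noteq> 0 \<and>
            Re (of_real \<alpha> * (Q_CV f z / Q_ST f z) - of_real \<beta> * Q_SD f z * Q_CV f z) < 3 * \<alpha> / 2) \<or>
         (\<forall>z\<in>ball 0 1. Q_ST f z \<noteq> 0 \<and>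
            Re (of_real \<alpha> * (Q_CV f z / Q_ST f z) - of_real \<beta> * Q_SD f z * Q_ST f z) < 3 * \<alpha> / 2) \<or>
         (\<forall>z\<in>ball 0 1. Q_CV f z \<noteq> 0 \<and>
            Re (of_real \<alpha> * (Q_ST f z / Q_CV f z) + of_real \<beta> * Q_SD f z * Q_CV f z) > 2 * \<alpha> / 3) \<or>
         (\<forall>z\<in>ball 0 1. Q_CV f z \<noteq> 0 \<and>
            Re (of_real \<alpha> * (Q_ST f z / Q_CV f z) + of_real \<beta> * Q_SD f z * Q_ST f z) > 2 * \<alpha> / 3)"
  shows "starlike_fn f"
proof -
  interpret class_A_nonvanishing f
    using assms(3,4) by unfold_locales auto
  have "Re (Q_ST f \<zeta>) > 0" if \<zeta>: "\<zeta> \<in> ball 0 1" for \<zeta>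
  proof (rule ccontr)
    assume "\<not> Re (Q_ST f \<zeta>) > 0"
    then obtain z k where z: "z \<in> ball 0 1" and k: "k > 3/2"
      and CV: "Q_CV f z = of_real k * Q_ST f z" and SD: "Re (Q_SD f z * Q_ST f z) \<le> 0"
      using first_exit_values[OF \<zeta>] by (auto simp: not_less)
    have quot: "Q_CV f z / Q_ST f z = of_real k" "Q_ST f z / Q_CV f z = of_real (1 / k)"
      using Q_ST_nonzero[OF z] k by (simp_all add: CV)
    have Re_scale: "Re (of_real a * w) = a * Re w" for a w
      by simp
    have "of_real \<beta> * Q_SD f z * Q_ST f z = of_real \<beta> * (Q_SD f z * Q_ST f z)"
      and "of_real \<beta> * Q_SD f z * Q_CV f z = of_real (\<beta> * k) * (Q_SD f z * Q_ST f z)"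
      by (simp_all add: CV)
    then have ST_term: "Re (of_real \<beta> * Q_SD f z * Q_ST f z) \<le> 0"
      and CV_term: "Re (of_real \<beta> * Q_SD f z * Q_CV f z) \<le> 0"
      using SD k assms(2) by (simp_all only: Re_scale) (intro mult_nonneg_nonpos; simp)+
    have large: "Re (of_real \<alpha> * (Q_CV f z / Q_ST f z)) > 3 * \<alpha> / 2"
      using k assms(1) by (simp add: quot(1) mult.commute)
    have small: "Re (of_real \<alpha> * (Q_ST f z / Q_CV f z)) < 2 * \<alpha> / 3"
      using k assms(1) by (simp add: quot(2) field_simps)
    from assms(5) show False
      using z large small ST_term CV_term
      by (elim disjE) (force dest!: bspec[OF _ z])+
  qed
  then show ?thesis
    using assms(3) f_nonzero by (simp add: starlike_fn_def)
qed

end
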